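(* Let $\theta\in(0,1]$, $r>0$, $s>0$ satisfy $rs<1/\|\mathcal{L}\mathcal{L}^*\|$, and let $\rho,\sigma$ satisfy: $\rho=\sigma\in(0,2)$ if $\theta=1$; and $\rho\in(0,1+\theta-\sqrt{1-\theta}\,]$, $\sigma=\rho/\theta$ if $\theta\in(0,1)$. Let $\{w^k=(u_0^k,p^k)^\top\}$ and $\{\widetilde w^k=(\widetilde u_0^k,\widetilde p^{\,k})^\top\}$ be the sequences generated, from arbitrary initial value $w^0=(u_0^0,p^0)^\top\in L^2(\Omega)\times L^2(\Omega)$, by the generalized primal-dual algorithm (described in the context) with these parameters, and let $w^*=(u_0^*,p^* )^\top$ be the solution (saddle point) of $$\min_{u_0\in L^2(\Omega)}\max_{p\in L^2(\Omega)}\Big(g(u_0)+\int_\Omega p\,\mathcal{L}u_0\,dx-f^*(p)\Big).$$ Then there exists a constant $c_0>0$, independent of $K$, such that for any $K\in\mathbb{N}$, $$\|\mathcal{D}(w^K-\widetilde w^K)\|_{\mathcal{K}}^2\le\frac1{c_0(K+1)}\|w^0-w^*\|_{\mathcal{K}}^2.$$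
   Context: Setting. $\Omega\subset\mathbb{R}^N$, $N\ge1$, is a bounded domain, $0<T<\infty$, $d>0$ is a constant, $v\in\mathbb{R}^N$ is a constant vector, $u_T\in L^2(\Omega)$ is given, and $\tau>0$, $\beta>0$ are constants. $\mathcal{L}:L^2(\Omega)\to L^2(\Omega)$ is the (bounded linear) solution operator $\mathcal{L}u_0=u(\cdot,T)$ of $$\partial_t u-d\Delta u+v\cdot\nabla u=0\ \text{in }\Omega\times(0,T),\quad u=0\ \text{on }\partial\Omega\times(0,T),\quad u(\cdot,0)=u_0,$$ and $\mathcal{L}^*$ is its adjoint. $\|\mathcal{L}\mathcal{L}^*\|$ is the operator norm. Functionals. $g(u_0)=\frac{\tau}{2}\int_\Omega|u_0|^2dx+\beta\int_\Omega|u_0|dx$, and $f^*(p)=\frac12\int_\Omega|p|^2dx+\int_\Omega p\,u_T\,dx$ (the convex conjugate of $f(q)=\frac12\int_\Omega|q-u_T|^2dx$). Generalized primal-dual algorithm. Given $(u_0^0,p^0)\in L^2(\Omega)\times L^2(\Omega)$, for $k=0,1,2,\dots$ compute $$\widetilde u_0^k=\arg\min_{u_0\in L^2(\Omega)}\Big(g(u_0)+\int_\Omega p^k\mathcal{L}u_0\,dx+\tfrac1{2r}\|u_0-u_0^k\|^2_{L^2(\Omega)}\Big),$$ $$\bar u_0^k=\widetilde u_0^k+\theta(\widetilde u_0^k-u_0^k),$$ $$\widetilde p^{\,k}=\arg\max_{p\in L^2(\Omega)}\Big(\int_\Omega p\,\mathcal{L}\bar u_0^k\,dx-f^*(p)-\tfrac1{2s}\|p-p^k\|^2_{L^2(\Omega)}\Big),$$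 $$u_0^{k+1}=u_0^k-\rho(u_0^k-\widetilde u_0^k),\qquad p^{k+1}=p^k-\sigma(p^k-\widetilde p^{\,k}).$$ Notation. $W=L^2(\Omega)\times L^2(\Omega)$ with its canonical inner product $(\cdot,\cdot)$. Define operators on $W$ by $$\mathcal{D}=\begin{pmatrix}\rho I&0\\0&\sigma I\end{pmatrix},\quad G=\begin{pmatrix}\frac1rI&-\mathcal{L}^*\\-\theta\mathcal{L}&\frac1sI\end{pmatrix},\quad \mathcal{K}=G\mathcal{D}^{-1}.$$ Under the stated parameter conditions $\mathcal{K}$ is self-adjoint and positive definite, and $\|w\|_{\mathcal{K}}^2:=(\mathcal{K}w,w)$. *)

theory Defs
  imports "HOL-Analysis.Analysis"
begin

section \<open>The Lebesgue space \<open>L\<^sup>2(\<Omega>)\<close>\<close>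

text \<open>
  Elements of \<open>L\<^sup>2(\<Omega>)\<close> are represented by functions; equality in \<open>L\<^sup>2(\<Omega>)\<close> is equality almost
  everywhere, and everything outside \<open>\<Omega>\<close> is irrelevant. The value space is a Euclidean space, so
  that the same definitions serve for scalar functions and for gradients.
\<close>

definition L2 :: "'a::euclidean_space set \<Rightarrow> ('a \<Rightarrow> 'b::euclidean_space) set" where
  "L2 \<Omega> = {f \<in> borel_measurable (lebesgue_on \<Omega>). integrable (lebesgue_on \<Omega>) (\<lambda>x. (norm (f x))\<^sup>2)}"

definition L2_eq :: "'a::euclidean_space set \<Rightarrow> ('a \<Rightarrow> 'b::euclidean_space) \<Rightarrow> ('a \<Rightarrow> 'b) \<Rightarrow> bool" where
  "L2_eq \<Omega> f g \<longleftrightarrow> (AE x in lebesgue_on \<Omega>. f x = g x)"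

definition L2_inner :: "'a::euclidean_space set \<Rightarrow> ('a \<Rightarrow> 'b::euclidean_space) \<Rightarrow> ('a \<Rightarrow> 'b) \<Rightarrow> real" where
  "L2_inner \<Omega> f g = (LINT x|lebesgue_on \<Omega>. f x \<bullet> g x)"

definition L2_norm :: "'a::euclidean_space set \<Rightarrow> ('a \<Rightarrow> 'b::euclidean_space) \<Rightarrow> real" where
  "L2_norm \<Omega> f = sqrt (L2_inner \<Omega> f f)"

definition L2_bounded_linear :: "'a::euclidean_space set \<Rightarrow> (('a \<Rightarrow> real) \<Rightarrow> ('a \<Rightarrow> real)) \<Rightarrow> bool" where
  "L2_bounded_linear \<Omega> A \<longleftrightarrow>
     (\<forall>f\<in>L2 \<Omega>. A f \<in> L2 \<Omega>) \<and>
     (\<forall>f\<in>L2 \<Omega>. \<forall>g\<in>L2 \<Omega>. L2_eq \<Omega> (A (\<lambda>x. f x + g x)) (\<lambda>x. A f x + A g x)) \<and>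
     (\<forall>c. \<forall>f\<in>L2 \<Omega>. L2_eq \<Omega> (A (\<lambda>x. c * f x)) (\<lambda>x. c * A f x)) \<and>
     (\<exists>C. \<forall>f\<in>L2 \<Omega>. L2_norm \<Omega> (A f) \<le> C * L2_norm \<Omega> f)"

definition L2_adjoint ::
  "'a::euclidean_space set \<Rightarrow> (('a \<Rightarrow> real) \<Rightarrow> ('a \<Rightarrow> real)) \<Rightarrow> (('a \<Rightarrow> real) \<Rightarrow> ('a \<Rightarrow> real)) \<Rightarrow> bool" where
  "L2_adjoint \<Omega> A B \<longleftrightarrow>
     (\<forall>g\<in>L2 \<Omega>. B g \<in> L2 \<Omega>) \<and>
     (\<forall>f\<in>L2 \<Omega>. \<forall>g\<in>L2 \<Omega>. L2_inner \<Omega> (A f) g = L2_inner \<Omega> f (B g))"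

text \<open>Same shape as the library's \<^const>\<open>onorm\<close>; null functions contribute the quotient \<open>0 / 0 = 0\<close>.\<close>

definition L2_onorm :: "'a::euclidean_space set \<Rightarrow> (('a \<Rightarrow> real) \<Rightarrow> ('a \<Rightarrow> real)) \<Rightarrow> real" where
  "L2_onorm \<Omega> A = (SUP f\<in>L2 \<Omega>. L2_norm \<Omega> (A f) / L2_norm \<Omega> f)"


section \<open>The Sobolev space \<open>H\<^sup>1\<^sub>0(\<Omega>)\<close>\<close>

fun Ck :: "nat \<Rightarrow> ('a::euclidean_space \<Rightarrow> real) \<Rightarrow> bool" where
  "Ck 0 f \<longleftrightarrow> continuous_on UNIV f"
| "Ck (Suc k) f \<longleftrightarrow>
     (\<forall>x. f differentiable (at x)) \<and> (\<forall>i\<in>Basis. Ck k (\<lambda>x. frechet_derivative f (at x) i))"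

definition test_function :: "'a::euclidean_space set \<Rightarrow> ('a \<Rightarrow> real) \<Rightarrow> bool" where
  "test_function \<Omega> \<phi> \<longleftrightarrow> (\<forall>k. Ck k \<phi>) \<and> (\<exists>C. compact C \<and> C \<subseteq> \<Omega> \<and> (\<forall>x. x \<notin> C \<longrightarrow> \<phi> x = 0))"

definition gradient :: "('a::euclidean_space \<Rightarrow> real) \<Rightarrow> 'a \<Rightarrow> 'a" where
  "gradient f x = (\<Sum>i\<in>Basis. frechet_derivative f (at x) i *\<^sub>R i)"

text \<open>
  \<open>f\<close> belongs to \<open>H\<^sup>1\<^sub>0(\<Omega>)\<close>, the closure of the test functions in the \<open>H\<^sup>1\<close>-norm, and \<open>Df\<close> is its
  weak gradient.
\<close>

definition H10_gradient :: "'a::euclidean_space set \<Rightarrow> ('a \<Rightarrow> real) \<Rightarrow> ('a \<Rightarrow> 'a) \<Rightarrow> bool" where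
  "H10_gradient \<Omega> f Df \<longleftrightarrow>
     f \<in> L2 \<Omega> \<and> Df \<in> L2 \<Omega> \<and>
     (\<exists>\<phi> :: nat \<Rightarrow> 'a \<Rightarrow> real.
        (\<forall>n. test_function \<Omega> (\<phi> n)) \<and>
        (\<lambda>n. L2_norm \<Omega> (\<lambda>x. \<phi> n x - f x)) \<longlonglongrightarrow> 0 \<and>
        (\<lambda>n. L2_norm \<Omega> (\<lambda>x. gradient (\<phi> n) x - Df x)) \<longlonglongrightarrow> 0)"


section \<open>The advection-diffusion equation and its solution operator\<close>

text \<open>
  Weak solutions of \<open>\<partial>\<^sub>t u - d \<Delta>u + v \<cdot> \<nabla>u = 0\<close> in \<open>\<Omega> \<times> (0,T)\<close>, \<open>u = 0\<close> on \<open>\<partial>\<Omega> \<times> (0,T)\<close>, \<open>u(0) = u\<^sub>0\<close>: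
  \<open>u \<in> C([0,T]; L\<^sup>2(\<Omega>)) \<inter> L\<^sup>2(0,T; H\<^sup>1\<^sub>0(\<Omega>))\<close>, and the equation
  \<open>\<langle>\<partial>\<^sub>t u, w\<rangle> + d (\<nabla>u, \<nabla>w) + (v \<cdot> \<nabla>u, w) = 0\<close> for all \<open>w \<in> H\<^sup>1\<^sub>0(\<Omega>)\<close> is written in its form integrated
  over \<open>(0,t)\<close>, so that the dual space \<open>H\<^sup>-\<^sup>1(\<Omega>)\<close> of the time derivative is not needed.
\<close>

definition weak_solution ::
  "'a::euclidean_space set \<Rightarrow> real \<Rightarrow> 'a \<Rightarrow> real \<Rightarrow> ('a \<Rightarrow> real) \<Rightarrow> (real \<Rightarrow> 'a \<Rightarrow> real) \<Rightarrow> bool" where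
  "weak_solution \<Omega> d v T u0 u \<longleftrightarrow>
     (\<forall>t\<in>{0..T}. u t \<in> L2 \<Omega>) \<and>
     (\<forall>t\<in>{0..T}. ((\<lambda>s. L2_norm \<Omega> (\<lambda>x. u s x - u t x)) \<longlongrightarrow> 0) (at t within {0..T})) \<and>
     L2_eq \<Omega> (u 0) u0 \<and>
     (\<exists>Du :: real \<Rightarrow> 'a \<Rightarrow> 'a.
        (\<lambda>(t, x). Du t x) \<in> L2 ({0<..<T} \<times> \<Omega>) \<and>
        (AE t in lebesgue_on {0<..<T}. H10_gradient \<Omega> (u t) (Du t)) \<and>
        (\<forall>w Dw. H10_gradient \<Omega> w Dw \<longrightarrow>
           (\<forall>t\<in>{0..T}.
              L2_inner \<Omega> (u t) w - L2_inner \<Omega> u0 w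
              + (LINT s|lebesgue_on {0..t}.
                   d * L2_inner \<Omega> (Du s) Dw + L2_inner \<Omega> (\<lambda>x. v \<bullet> Du s x) w) = 0)))"

definition solution_operator ::
  "'a::euclidean_space set \<Rightarrow> real \<Rightarrow> 'a \<Rightarrow> real \<Rightarrow> (('a \<Rightarrow> real) \<Rightarrow> ('a \<Rightarrow> real)) \<Rightarrow> bool" where
  "solution_operator \<Omega> d v T L \<longleftrightarrow>
     (\<forall>u0\<in>L2 \<Omega>. \<exists>u. weak_solution \<Omega> d v T u0 u \<and> L2_eq \<Omega> (L u0) (u T))"


section \<open>The saddle point problem and the generalized primal-dual algorithm\<close>

definition g_fun :: "'a::euclidean_space set \<Rightarrow> real \<Rightarrow> real \<Rightarrow> ('a \<Rightarrow> real) \<Rightarrow> real" where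
  "g_fun \<Omega> \<tau> \<beta> u0 =
     \<tau> / 2 * (LINT x|lebesgue_on \<Omega>. \<bar>u0 x\<bar>\<^sup>2) + \<beta> * (LINT x|lebesgue_on \<Omega>. \<bar>u0 x\<bar>)"

definition f_conj :: "'a::euclidean_space set \<Rightarrow> ('a \<Rightarrow> real) \<Rightarrow> ('a \<Rightarrow> real) \<Rightarrow> real" where
  "f_conj \<Omega> uT p =
     1 / 2 * (LINT x|lebesgue_on \<Omega>. \<bar>p x\<bar>\<^sup>2) + (LINT x|lebesgue_on \<Omega>. p x * uT x)"

definition saddle_fun ::
  "'a::euclidean_space set \<Rightarrow> real \<Rightarrow> real \<Rightarrow> ('a \<Rightarrow> real) \<Rightarrow> (('a \<Rightarrow> real) \<Rightarrow> ('a \<Rightarrow> real))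
     \<Rightarrow> ('a \<Rightarrow> real) \<Rightarrow> ('a \<Rightarrow> real) \<Rightarrow> real" where
  "saddle_fun \<Omega> \<tau> \<beta> uT L u0 p =
     g_fun \<Omega> \<tau> \<beta> u0 + (LINT x|lebesgue_on \<Omega>. p x * L u0 x) - f_conj \<Omega> uT p"

definition saddle_point ::
  "'a::euclidean_space set \<Rightarrow> real \<Rightarrow> real \<Rightarrow> ('a \<Rightarrow> real) \<Rightarrow> (('a \<Rightarrow> real) \<Rightarrow> ('a \<Rightarrow> real))
     \<Rightarrow> ('a \<Rightarrow> real) \<times> ('a \<Rightarrow> real) \<Rightarrow> bool" where
  "saddle_point \<Omega> \<tau> \<beta> uT L = (\<lambda>(us, ps).
     us \<in> L2 \<Omega> \<and> ps \<in> L2 \<Omega> \<and>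
     (\<forall>u\<in>L2 \<Omega>. \<forall>p\<in>L2 \<Omega>.
        saddle_fun \<Omega> \<tau> \<beta> uT L us p \<le> saddle_fun \<Omega> \<tau> \<beta> uT L us ps \<and>
        saddle_fun \<Omega> \<tau> \<beta> uT L us ps \<le> saddle_fun \<Omega> \<tau> \<beta> uT L u ps))"

text \<open>
  The sequences \<open>u\<close>, \<open>p\<close>, \<open>ut\<close>, \<open>pt\<close> are \<open>u\<^sub>0\<^sup>k\<close>, \<open>p\<^sup>k\<close> and the predictors carrying a tilde;
  the initial value is \<open>(u 0, p 0)\<close>.
\<close>

definition primal_dual_iteration ::
  "'a::euclidean_space set \<Rightarrow> real \<Rightarrow> real \<Rightarrow> ('a \<Rightarrow> real) \<Rightarrow> (('a \<Rightarrow> real) \<Rightarrow> ('a \<Rightarrow> real))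
     \<Rightarrow> real \<Rightarrow> real \<Rightarrow> real \<Rightarrow> real \<Rightarrow> real
     \<Rightarrow> (nat \<Rightarrow> 'a \<Rightarrow> real) \<Rightarrow> (nat \<Rightarrow> 'a \<Rightarrow> real) \<Rightarrow> (nat \<Rightarrow> 'a \<Rightarrow> real) \<Rightarrow> (nat \<Rightarrow> 'a \<Rightarrow> real) \<Rightarrow> bool" where
  "primal_dual_iteration \<Omega> \<tau> \<beta> uT L \<theta> r s \<rho> \<sigma> u p ut pt \<longleftrightarrow>
     (\<forall>k. u k \<in> L2 \<Omega> \<and> p k \<in> L2 \<Omega>) \<and>
     (\<forall>k. is_arg_min
            (\<lambda>u0. g_fun \<Omega> \<tau> \<beta> u0 + (LINT x|lebesgue_on \<Omega>. p k x * L u0 x)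
                  + 1 / (2 * r) * (L2_norm \<Omega> (\<lambda>x. u0 x - u k x))\<^sup>2)
            (\<lambda>u0. u0 \<in> L2 \<Omega>) (ut k)) \<and>
     (\<forall>k. is_arg_max
            (\<lambda>q. (LINT x|lebesgue_on \<Omega>. q x * L (\<lambda>y. ut k y + \<theta> * (ut k y - u k y)) x)
                  - f_conj \<Omega> uT q
                  - 1 / (2 * s) * (L2_norm \<Omega> (\<lambda>x. q x - p k x))\<^sup>2)
            (\<lambda>q. q \<in> L2 \<Omega>) (pt k)) \<and>
     (\<forall>k. L2_eq \<Omega> (u (Suc k)) (\<lambda>x. u k x - \<rho> * (u k x - ut k x))) \<and>
     (\<forall>k. L2_eq \<Omega> (p (Suc k)) (\<lambda>x. p k x - \<sigma> * (p k x - pt k x)))"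


section \<open>Operators on \<open>W = L\<^sup>2(\<Omega>) \<times> L\<^sup>2(\<Omega>)\<close>\<close>

type_synonym 'a W = "('a \<Rightarrow> real) \<times> ('a \<Rightarrow> real)"

definition W_inner :: "'a::euclidean_space set \<Rightarrow> 'a W \<Rightarrow> 'a W \<Rightarrow> real" where
  "W_inner \<Omega> w z = L2_inner \<Omega> (fst w) (fst z) + L2_inner \<Omega> (snd w) (snd z)"

definition W_diff :: "'a W \<Rightarrow> 'a W \<Rightarrow> 'a W" where
  "W_diff w z = ((\<lambda>x. fst w x - fst z x), (\<lambda>x. snd w x - snd z x))"

definition D_op :: "real \<Rightarrow> real \<Rightarrow> 'a W \<Rightarrow> 'a W" where
  "D_op \<rho> \<sigma> = (\<lambda>(u, p). ((\<lambda>x. \<rho> * u x), (\<lambda>x. \<sigma> * p x)))"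

definition G_op ::
  "(('a \<Rightarrow> real) \<Rightarrow> ('a \<Rightarrow> real)) \<Rightarrow> (('a \<Rightarrow> real) \<Rightarrow> ('a \<Rightarrow> real))
     \<Rightarrow> real \<Rightarrow> real \<Rightarrow> real \<Rightarrow> 'a W \<Rightarrow> 'a W" where
  "G_op L Ls \<theta> r s =
     (\<lambda>(u, p). ((\<lambda>x. 1 / r * u x - Ls p x), (\<lambda>x. - \<theta> * L u x + 1 / s * p x)))"

definition K_op ::
  "(('a \<Rightarrow> real) \<Rightarrow> ('a \<Rightarrow> real)) \<Rightarrow> (('a \<Rightarrow> real) \<Rightarrow> ('a \<Rightarrow> real))
     \<Rightarrow> real \<Rightarrow> real \<Rightarrow> real \<Rightarrow> real \<Rightarrow> real \<Rightarrow> 'a W \<Rightarrow> 'a W" where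
  "K_op L Ls \<theta> r s \<rho> \<sigma> = G_op L Ls \<theta> r s \<circ> inv (D_op \<rho> \<sigma>)"

text \<open>The squared norm \<open>\<parallel>w\<parallel>\<^sub>K\<^sup>2 = (K w, w)\<close>.\<close>

definition K_normsq ::
  "'a::euclidean_space set \<Rightarrow> (('a \<Rightarrow> real) \<Rightarrow> ('a \<Rightarrow> real)) \<Rightarrow> (('a \<Rightarrow> real) \<Rightarrow> ('a \<Rightarrow> real))
     \<Rightarrow> real \<Rightarrow> real \<Rightarrow> real \<Rightarrow> real \<Rightarrow> real \<Rightarrow> 'a W \<Rightarrow> real" where
  "K_normsq \<Omega> L Ls \<theta> r s \<rho> \<sigma> w = W_inner \<Omega> (K_op L Ls \<theta> r s \<rho> \<sigma> w) w"

end

theory Submission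
  imports Defs
begin

text \<open>
  The algorithm is a relaxed, preconditioned proximal point method. The two proximal steps together
  say that the predictor \<open>w~\<close> solves the variational inequality of the saddle point problem
  perturbed by \<open>G (w~ - w)\<close> (\<open>primal_dual_resolvent_inequality\<close>), and a saddle point solves it
  without perturbation. The saddle point operator is monotone; comparing two such inequalities
  therefore gives \<open>(G (e - e'), w~ - w~') \<ge> 0\<close> for the residuals \<open>e = w - w~\<close>
  (\<open>resolvent_monotone\<close>).

  The correction step is \<open>w \<mapsto> w - D e\<close>. Since \<open>\<theta> \<sigma> = \<rho>\<close>, the form \<open>S(w,z) = (G w, D z)\<close> is
  symmetric, and \<open>\<parallel>D w\<parallel>\<^sub>K\<^sup>2 = S(w,w)\<close>. Expanding \<open>\<parallel>w - w\<^sup>* - D e\<parallel>\<^sub>K\<^sup>2\<close> and inserting the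
  monotonicity inequality shows that the squared error falls by at least \<open>2 (G e, e) - S(e,e)\<close>. The
  parameter conditions are what makes this quantity at least \<open>c0 S(e,e)\<close> (\<open>relaxation_coercive\<close>,
  \<open>S_form_coercive\<close>), with \<open>c0\<close> depending only on \<open>\<theta>\<close>, \<open>\<rho>\<close> and \<open>r s \<parallel>L L\<^sup>*\<parallel>\<close>. Hence the
  squared residuals \<open>S(e,e)\<close> sum to at most \<open>\<parallel>w\<^sup>0 - w\<^sup>*\<parallel>\<^sub>K\<^sup>2 / c0\<close> (\<open>Fejer_descent\<close>). Monotonicity
  between two consecutive predictors shows that they do not increase
  (\<open>residual_antimono\<close>), so the last of \<open>K + 1\<close> of them is at most their average.

  All computations take place among representatives of \<open>L\<^sup>2\<close> classes with the semi-inner product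
  \<open>L2_inner\<close>; the correction step holds almost everywhere, and the forms do not see null sets.
\<close>


section \<open>\<open>L\<^sup>2(\<Omega>)\<close> as a space with a semi-inner product\<close>

lemma L2_iff:
  "f \<in> L2 \<Omega> \<longleftrightarrow> f \<in> borel_measurable (lebesgue_on \<Omega>) \<and> integrable (lebesgue_on \<Omega>) (\<lambda>x. (f x)\<^sup>2)"
  for f :: "'a::euclidean_space \<Rightarrow> real"
  by (simp add: L2_def)

lemma L2_mult_integrable:
  fixes f g :: "'a::euclidean_space \<Rightarrow> real"
  assumes "f \<in> L2 \<Omega>" "g \<in> L2 \<Omega>"
  shows "integrable (lebesgue_on \<Omega>) (\<lambda>x. f x * g x)"
proof (rule Bochner_Integration.integrable_bound)
  show "integrable (lebesgue_on \<Omega>) (\<lambda>x. (f x)\<^sup>2 + (g x)\<^sup>2)"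
    using assms by (simp add: L2_iff)
  show "(\<lambda>x. f x * g x) \<in> borel_measurable (lebesgue_on \<Omega>)"
    using assms by (simp add: L2_iff borel_measurable_times)
  have "\<bar>a * b\<bar> \<le> \<bar>a\<^sup>2 + b\<^sup>2\<bar>" for a b :: real
    using sum_squares_bound[of "\<bar>a\<bar>" "\<bar>b\<bar>"] mult_nonneg_nonneg[of "\<bar>a\<bar>" "\<bar>b\<bar>"]
      zero_le_power2[of a] zero_le_power2[of b]
    unfolding abs_mult power2_abs by linarith
  then show "AE x in lebesgue_on \<Omega>. norm (f x * g x) \<le> norm ((f x)\<^sup>2 + (g x)\<^sup>2)"
    by simp
qed

lemma L2_add [simp]:
  fixes f g :: "'a::euclidean_space \<Rightarrow> real"
  assumes "f \<in> L2 \<Omega>" "g \<in> L2 \<Omega>"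
  shows "(\<lambda>x. f x + g x) \<in> L2 \<Omega>"
  using assms L2_mult_integrable[OF assms]
  by (simp add: L2_iff power2_sum borel_measurable_add mult.assoc)

lemma L2_scale [simp]:
  fixes f :: "'a::euclidean_space \<Rightarrow> real"
  assumes "f \<in> L2 \<Omega>"
  shows "(\<lambda>x. c * f x) \<in> L2 \<Omega>"
  using assms by (simp add: L2_iff power_mult_distrib borel_measurable_times)

lemma L2_diff [simp]:
  fixes f g :: "'a::euclidean_space \<Rightarrow> real"
  assumes "f \<in> L2 \<Omega>" "g \<in> L2 \<Omega>"
  shows "(\<lambda>x. f x - g x) \<in> L2 \<Omega>"
  using L2_add[OF assms(1) L2_scale[OF assms(2), of "-1"]] by simp

lemma L2_inner_real: "L2_inner \<Omega> f g = (LINT x|lebesgue_on \<Omega>. f x * g x)"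
  for f :: "'a::euclidean_space \<Rightarrow> real"
  by (simp add: L2_inner_def)

lemma L2_inner_commute: "L2_inner \<Omega> f g = L2_inner \<Omega> g f"
  by (simp add: L2_inner_def inner_commute)

lemma L2_inner_scale_left [simp]: "L2_inner \<Omega> (\<lambda>x. c * f x) g = c * L2_inner \<Omega> f g"
  for f :: "'a::euclidean_space \<Rightarrow> real"
  by (simp add: L2_inner_real mult.assoc)

lemma L2_inner_scale_right [simp]: "L2_inner \<Omega> f (\<lambda>x. c * g x) = c * L2_inner \<Omega> f g"
  for f :: "'a::euclidean_space \<Rightarrow> real"
  by (simp add: L2_inner_real mult.left_commute)

lemma L2_inner_add_left [simp]:
  fixes f g h :: "'a::euclidean_space \<Rightarrow> real"
  assumes "f \<in> L2 \<Omega>" "g \<in> L2 \<Omega>" "h \<in> L2 \<Omega>"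
  shows "L2_inner \<Omega> (\<lambda>x. f x + g x) h = L2_inner \<Omega> f h + L2_inner \<Omega> g h"
  using assms by (simp add: L2_inner_real distrib_right L2_mult_integrable)

lemma L2_inner_diff_left [simp]:
  fixes f g h :: "'a::euclidean_space \<Rightarrow> real"
  assumes "f \<in> L2 \<Omega>" "g \<in> L2 \<Omega>" "h \<in> L2 \<Omega>"
  shows "L2_inner \<Omega> (\<lambda>x. f x - g x) h = L2_inner \<Omega> f h - L2_inner \<Omega> g h"
  using assms by (simp add: L2_inner_real left_diff_distrib L2_mult_integrable)

lemma L2_inner_add_right [simp]:
  fixes f g h :: "'a::euclidean_space \<Rightarrow> real"
  assumes "f \<in> L2 \<Omega>" "g \<in> L2 \<Omega>" "h \<in> L2 \<Omega>"
  shows "L2_inner \<Omega> h (\<lambda>x. f x + g x) = L2_inner \<Omega> h f + L2_inner \<Omega> h g"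
  using assms by (simp add: L2_inner_commute[of \<Omega> h])

lemma L2_inner_diff_right [simp]:
  fixes f g h :: "'a::euclidean_space \<Rightarrow> real"
  assumes "f \<in> L2 \<Omega>" "g \<in> L2 \<Omega>" "h \<in> L2 \<Omega>"
  shows "L2_inner \<Omega> h (\<lambda>x. f x - g x) = L2_inner \<Omega> h f - L2_inner \<Omega> h g"
  using assms by (simp add: L2_inner_commute[of \<Omega> h])

lemma L2_inner_nonneg [simp]: "0 \<le> L2_inner \<Omega> f f"
  by (simp add: L2_inner_def)

lemma L2_norm_power2 [simp]: "(L2_norm \<Omega> f)\<^sup>2 = L2_inner \<Omega> f f"
  by (simp add: L2_norm_def)

lemma L2_norm_nonneg [simp]: "0 \<le> L2_norm \<Omega> f"
  by (simp add: L2_norm_def)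

lemma L2_inner_cong_AE:
  fixes f g h :: "'a::euclidean_space \<Rightarrow> real"
  assumes eq: "L2_eq \<Omega> f g" and mem: "f \<in> L2 \<Omega>" "g \<in> L2 \<Omega>" "h \<in> L2 \<Omega>"
  shows "L2_inner \<Omega> f h = L2_inner \<Omega> g h"
  unfolding L2_inner_real
proof (rule integral_cong_AE)
  show "AE x in lebesgue_on \<Omega>. f x * h x = g x * h x"
    using eq unfolding L2_eq_def by eventually_elim simp
qed (use mem in \<open>auto simp: L2_iff intro: borel_measurable_times\<close>)

lemma L2_Cauchy_Schwarz:
  fixes f g :: "'a::euclidean_space \<Rightarrow> real"
  assumes "f \<in> L2 \<Omega>" "g \<in> L2 \<Omega>"
  shows "\<bar>L2_inner \<Omega> f g\<bar> \<le> L2_norm \<Omega> f * L2_norm \<Omega> g"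
proof -
  let ?a = "L2_inner \<Omega> f f" and ?b = "L2_inner \<Omega> f g" and ?c = "L2_inner \<Omega> g g"
  have pos: "0 \<le> ?a - 2 * t * ?b + t\<^sup>2 * ?c" for t
    using L2_inner_nonneg[of \<Omega> "\<lambda>x. f x - t * g x"] assms
    by (simp add: L2_inner_commute[of \<Omega> g f] power2_eq_square algebra_simps)
  have "?b\<^sup>2 \<le> ?a * ?c"
  proof (cases "?c = 0")
    case True
    \<comment> \<open>\<open>?a - 2 t ?b\<close> is nonnegative for all \<open>t\<close>, but equals \<open>-1\<close> for the chosen one unless \<open>?b = 0\<close>.\<close>
    have "?b = 0"
    proof (rule ccontr)
      assume "?b \<noteq> 0"
      then show False using pos[of "(?a + 1) / (2 * ?b)"] True by (simp add: field_simps)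
    qed
    then show ?thesis using True by simp
  next
    case False
    then have c: "0 < ?c" using L2_inner_nonneg[of \<Omega> g] by linarith
    have "0 \<le> ?a - ?b\<^sup>2 / ?c"
      using pos[of "?b / ?c"] c by (simp add: power2_eq_square field_simps)
    then show ?thesis using c by (simp add: field_simps)
  qed
  then have "sqrt (?b\<^sup>2) \<le> sqrt (?a * ?c)"
    by (rule real_sqrt_le_mono)
  then show ?thesis by (simp add: L2_norm_def real_sqrt_mult)
qed

lemma L2_adjoint_inner:
  assumes "L2_adjoint \<Omega> A B" "f \<in> L2 \<Omega>" "g \<in> L2 \<Omega>"
  shows "L2_inner \<Omega> (A f) g = L2_inner \<Omega> f (B g)" "B g \<in> L2 \<Omega>"
  using assms by (auto simp: L2_adjoint_def)

text \<open>
  From \<open>\<parallel>A\<^sup>* g\<parallel>\<^sup>2 = (A A\<^sup>* g, g)\<close> one gets both \<open>\<parallel>A\<^sup>*\<parallel> \<le> C\<close> for every bound \<open>C \<ge> 0\<close> of \<open>A\<close>, so that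
  the supremum defining \<open>\<parallel>A A\<^sup>*\<parallel>\<close> is one of a bounded set, and \<open>\<parallel>A\<^sup>* g\<parallel>\<^sup>2 \<le> \<parallel>A A\<^sup>*\<parallel> \<parallel>g\<parallel>\<^sup>2\<close>.
\<close>

lemma L2_norm_adjoint_le:
  assumes bl: "L2_bounded_linear \<Omega> A" and adj: "L2_adjoint \<Omega> A B" and g: "g \<in> L2 \<Omega>"
  shows "L2_norm \<Omega> (B g) \<le> sqrt (L2_onorm \<Omega> (A \<circ> B)) * L2_norm \<Omega> g"
proof -
  have mem: "B f \<in> L2 \<Omega>" "A f \<in> L2 \<Omega>" if "f \<in> L2 \<Omega>" for f
    using bl adj that by (auto simp: L2_bounded_linear_def L2_adjoint_def)
  obtain C where C: "\<And>f. f \<in> L2 \<Omega> \<Longrightarrow> L2_norm \<Omega> (A f) \<le> C * L2_norm \<Omega> f"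
    using bl unfolding L2_bounded_linear_def by blast
  define C' where "C' = max C 0"
  have C'0: "0 \<le> C'" by (simp add: C'_def)
  have C': "L2_norm \<Omega> (A f) \<le> C' * L2_norm \<Omega> f" if "f \<in> L2 \<Omega>" for f
    using C[OF that] mult_right_mono[of C C' "L2_norm \<Omega> f"] by (simp add: C'_def)
  have sq: "(L2_norm \<Omega> (B f))\<^sup>2 \<le> L2_norm \<Omega> (A (B f)) * L2_norm \<Omega> f" if f: "f \<in> L2 \<Omega>" for f
  proof -
    have "(L2_norm \<Omega> (B f))\<^sup>2 = L2_inner \<Omega> (A (B f)) f"
      using L2_adjoint_inner[OF adj mem(1)[OF f] f] by simp
    also have "\<dots> \<le> L2_norm \<Omega> (A (B f)) * L2_norm \<Omega> f"
      using L2_Cauchy_Schwarz[OF mem(2)[OF mem(1)[OF f]] f] by linarith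
    finally show ?thesis .
  qed
  have B: "L2_norm \<Omega> (B f) \<le> C' * L2_norm \<Omega> f" if f: "f \<in> L2 \<Omega>" for f
  proof (cases "L2_norm \<Omega> (B f) = 0")
    case True
    then show ?thesis using C'0 by simp
  next
    case False
    then have pos: "0 < L2_norm \<Omega> (B f)" using L2_norm_nonneg[of \<Omega> "B f"] by linarith
    have "L2_norm \<Omega> (B f) * L2_norm \<Omega> (B f) \<le> L2_norm \<Omega> (A (B f)) * L2_norm \<Omega> f"
      using sq[OF f] by (simp only: power2_eq_square)
    also have "\<dots> \<le> (C' * L2_norm \<Omega> (B f)) * L2_norm \<Omega> f"
      by (intro mult_right_mono C' mem f) simp
    finally have "L2_norm \<Omega> (B f) * L2_norm \<Omega> (B f) \<le> L2_norm \<Omega> (B f) * (C' * L2_norm \<Omega> f)"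
      by (simp add: mult_ac)
    then show ?thesis using pos by simp
  qed
  have AB: "L2_norm \<Omega> (A (B f)) \<le> C' * C' * L2_norm \<Omega> f" if f: "f \<in> L2 \<Omega>" for f
    using C'[OF mem(1)[OF f]] mult_left_mono[OF B[OF f] C'0] by (simp add: mult_ac)
  have "L2_norm \<Omega> ((A \<circ> B) f) / L2_norm \<Omega> f \<le> C' * C'" if "f \<in> L2 \<Omega>" for f
    using AB[OF that] L2_norm_nonneg[of \<Omega> f] C'0
    by (cases "L2_norm \<Omega> f = 0") (auto simp: divide_le_eq less_le)
  then have bdd: "bdd_above ((\<lambda>f. L2_norm \<Omega> ((A \<circ> B) f) / L2_norm \<Omega> f) ` L2 \<Omega>)"
    by (auto simp: bdd_above_def)
  have quot: "L2_norm \<Omega> (A (B g)) / L2_norm \<Omega> g \<le> L2_onorm \<Omega> (A \<circ> B)"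
    using cSUP_upper[OF g bdd] by (simp add: L2_onorm_def)
  have "L2_norm \<Omega> (A (B g)) \<le> L2_onorm \<Omega> (A \<circ> B) * L2_norm \<Omega> g"
  proof (cases "L2_norm \<Omega> g = 0")
    case True
    then show ?thesis using AB[OF g] by simp
  next
    case False
    then have "0 < L2_norm \<Omega> g" using L2_norm_nonneg[of \<Omega> g] by linarith
    then show ?thesis using quot by (simp add: divide_le_eq)
  qed
  then have "(L2_norm \<Omega> (B g))\<^sup>2 \<le> L2_onorm \<Omega> (A \<circ> B) * L2_norm \<Omega> g * L2_norm \<Omega> g"
    using sq[OF g] mult_right_mono[OF _ L2_norm_nonneg[of \<Omega> g]] by (meson order_trans)
  then have "sqrt ((L2_norm \<Omega> (B g))\<^sup>2) \<le> sqrt (L2_onorm \<Omega> (A \<circ> B) * (L2_norm \<Omega> g)\<^sup>2)"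
    by (intro real_sqrt_le_mono) (simp only: power2_eq_square mult.assoc)
  then show ?thesis by (simp only: real_sqrt_mult real_sqrt_abs abs_of_nonneg L2_norm_nonneg)
qed


section \<open>Convex functionals and proximal steps\<close>

definition L2_convex :: "'a::euclidean_space set \<Rightarrow> (('a \<Rightarrow> real) \<Rightarrow> real) \<Rightarrow> bool" where
  "L2_convex \<Omega> \<Phi> \<longleftrightarrow> (\<forall>f\<in>L2 \<Omega>. \<forall>g\<in>L2 \<Omega>. \<forall>t\<in>{0<..<1}.
     \<Phi> (\<lambda>x. f x + t * (g x - f x)) \<le> \<Phi> f + t * (\<Phi> g - \<Phi> f))"

lemma L2_convex_add:
  assumes "L2_convex \<Omega> \<Phi>" "L2_convex \<Omega> \<Psi>"
  shows "L2_convex \<Omega> (\<lambda>f. \<Phi> f + \<Psi> f)"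
  unfolding L2_convex_def
proof (intro ballI)
  fix f g :: "'a \<Rightarrow> real" and t :: real
  assume "f \<in> L2 \<Omega>" "g \<in> L2 \<Omega>" "t \<in> {0<..<1}"
  then have "\<Phi> (\<lambda>x. f x + t * (g x - f x)) \<le> \<Phi> f + t * (\<Phi> g - \<Phi> f)"
    "\<Psi> (\<lambda>x. f x + t * (g x - f x)) \<le> \<Psi> f + t * (\<Psi> g - \<Psi> f)"
    using assms by (auto simp: L2_convex_def)
  then show "\<Phi> (\<lambda>x. f x + t * (g x - f x)) + \<Psi> (\<lambda>x. f x + t * (g x - f x))
      \<le> \<Phi> f + \<Psi> f + t * (\<Phi> g + \<Psi> g - (\<Phi> f + \<Psi> f))"
    unfolding right_diff_distrib distrib_left by linarith
qed

lemma L2_convex_scale: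
  assumes "L2_convex \<Omega> \<Phi>" "0 \<le> c"
  shows "L2_convex \<Omega> (\<lambda>f. c * \<Phi> f)"
  unfolding L2_convex_def
proof (intro ballI)
  fix f g :: "'a \<Rightarrow> real" and t :: real
  assume "f \<in> L2 \<Omega>" "g \<in> L2 \<Omega>" "t \<in> {0<..<1}"
  then have "\<Phi> (\<lambda>x. f x + t * (g x - f x)) \<le> \<Phi> f + t * (\<Phi> g - \<Phi> f)"
    using assms by (simp add: L2_convex_def)
  from mult_left_mono[OF this assms(2)]
  show "c * \<Phi> (\<lambda>x. f x + t * (g x - f x)) \<le> c * \<Phi> f + t * (c * \<Phi> g - c * \<Phi> f)"
    by (simp add: algebra_simps)
qed

lemma L2_convex_inner_left:
  assumes "h \<in> L2 \<Omega>"
  shows "L2_convex \<Omega> (\<lambda>f. L2_inner \<Omega> f h)"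
  unfolding L2_convex_def using assms by simp

lemma L2_convex_inner_self: "L2_convex \<Omega> (\<lambda>f. L2_inner \<Omega> f f)"
  for \<Omega> :: "'a::euclidean_space set"
  unfolding L2_convex_def
proof (intro ballI)
  fix f g :: "'a \<Rightarrow> real" and t :: real
  assume f: "f \<in> L2 \<Omega>" and g: "g \<in> L2 \<Omega>" and t: "t \<in> {0<..<1}"
  let ?d = "\<lambda>x. g x - f x"
  have "L2_inner \<Omega> (\<lambda>x. f x + t * ?d x) (\<lambda>x. f x + t * ?d x)
      = L2_inner \<Omega> f f + t * (L2_inner \<Omega> g g - L2_inner \<Omega> f f) - t * (1 - t) * L2_inner \<Omega> ?d ?d"
    using f g by (simp add: L2_inner_commute[of \<Omega> g f] algebra_simps)
  moreover have "0 \<le> t * (1 - t) * L2_inner \<Omega> ?d ?d"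
    using t by simp
  ultimately show "L2_inner \<Omega> (\<lambda>x. f x + t * ?d x) (\<lambda>x. f x + t * ?d x)
      \<le> L2_inner \<Omega> f f + t * (L2_inner \<Omega> g g - L2_inner \<Omega> f f)"
    by linarith
qed

lemma L2_integrable_abs:
  fixes f :: "'a::euclidean_space \<Rightarrow> real"
  assumes "\<Omega> \<in> lmeasurable" and f: "f \<in> L2 \<Omega>"
  shows "integrable (lebesgue_on \<Omega>) (\<lambda>x. \<bar>f x\<bar>)"
proof (rule Bochner_Integration.integrable_bound)
  interpret finite_measure "lebesgue_on \<Omega>"
    using assms(1) by (rule finite_measure_lebesgue_on)
  show "integrable (lebesgue_on \<Omega>) (\<lambda>x. 1 + (f x)\<^sup>2)"
    using f by (simp add: L2_iff)
  show "(\<lambda>x. \<bar>f x\<bar>) \<in> borel_measurable (lebesgue_on \<Omega>)"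
    using f by (intro borel_measurable_abs) (simp add: L2_iff)
  have "\<bar>a\<bar> \<le> 1 + a\<^sup>2" for a :: real
    using sum_squares_bound[of 1 "\<bar>a\<bar>"] abs_ge_zero[of a] unfolding power2_abs by simp
  then show "AE x in lebesgue_on \<Omega>. norm \<bar>f x\<bar> \<le> norm (1 + (f x)\<^sup>2)"
    by simp
qed

text \<open>
  For a function that is not integrable the integral is \<open>0\<close>; the inclusion of \<open>L\<^sup>2\<close> in \<open>L\<^sup>1\<close>,
  valid on sets of finite measure, is what makes the \<open>L\<^sup>1\<close> norm convex.
\<close>

lemma L2_convex_L1_norm:
  assumes "\<Omega> \<in> lmeasurable"
  shows "L2_convex \<Omega> (\<lambda>f. LINT x|lebesgue_on \<Omega>. \<bar>f x\<bar>)"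
  unfolding L2_convex_def
proof (intro ballI)
  fix f g :: "'a \<Rightarrow> real" and t :: real
  assume f: "f \<in> L2 \<Omega>" and g: "g \<in> L2 \<Omega>" and t: "t \<in> {0<..<1}"
  note int = L2_integrable_abs[OF assms]
  have "(LINT x|lebesgue_on \<Omega>. \<bar>f x + t * (g x - f x)\<bar>)
      \<le> (LINT x|lebesgue_on \<Omega>. (1 - t) * \<bar>f x\<bar> + t * \<bar>g x\<bar>)"
  proof (rule integral_mono)
    fix x
    have "f x + t * (g x - f x) = (1 - t) * f x + t * g x" by (simp add: algebra_simps)
    also have "\<bar>\<dots>\<bar> \<le> (1 - t) * \<bar>f x\<bar> + t * \<bar>g x\<bar>"
      using t abs_triangle_ineq[of "(1 - t) * f x" "t * g x"] by (simp add: abs_mult)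
    finally show "\<bar>f x + t * (g x - f x)\<bar> \<le> (1 - t) * \<bar>f x\<bar> + t * \<bar>g x\<bar>" .
  qed (use f g in \<open>simp_all add: int\<close>)
  then show "(LINT x|lebesgue_on \<Omega>. \<bar>f x + t * (g x - f x)\<bar>)
      \<le> (LINT x|lebesgue_on \<Omega>. \<bar>f x\<bar>)
        + t * ((LINT x|lebesgue_on \<Omega>. \<bar>g x\<bar>) - (LINT x|lebesgue_on \<Omega>. \<bar>f x\<bar>))"
    using f g by (simp add: int algebra_simps)
qed

lemma g_fun_eq: "g_fun \<Omega> \<tau> \<beta> f = \<tau> / 2 * L2_inner \<Omega> f f + \<beta> * (LINT x|lebesgue_on \<Omega>. \<bar>f x\<bar>)"
  by (simp add: g_fun_def L2_inner_real power2_eq_square)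

lemma f_conj_eq: "f_conj \<Omega> uT q = 1 / 2 * L2_inner \<Omega> q q + L2_inner \<Omega> q uT"
  by (simp add: f_conj_def L2_inner_real power2_eq_square)

lemma L2_convex_g_fun:
  assumes "\<Omega> \<in> lmeasurable" "0 \<le> \<tau>" "0 \<le> \<beta>"
  shows "L2_convex \<Omega> (g_fun \<Omega> \<tau> \<beta>)"
  unfolding g_fun_eq[abs_def] using assms
  by (intro L2_convex_add L2_convex_scale L2_convex_inner_self L2_convex_L1_norm) auto

lemma L2_convex_f_conj:
  assumes "uT \<in> L2 \<Omega>"
  shows "L2_convex \<Omega> (f_conj \<Omega> uT)"
  unfolding f_conj_eq[abs_def] using assms
  by (intro L2_convex_add L2_convex_scale L2_convex_inner_self L2_convex_inner_left) auto

text \<open>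
  Comparing the minimizer \<open>m\<close> with the points \<open>m + t (f - m)\<close> gives the variational inequality
  up to an error of order \<open>t\<close>, which vanishes as \<open>t\<close> tends to \<open>0\<close>.
\<close>

lemma proximal_step_variational_inequality:
  fixes \<Omega> :: "'a::euclidean_space set"
  assumes cvx: "L2_convex \<Omega> \<Phi>" and c: "c \<in> L2 \<Omega>" and r: "0 < r"
    and argmin: "is_arg_min (\<lambda>f. \<Phi> f + 1 / (2 * r) * (L2_norm \<Omega> (\<lambda>x. f x - c x))\<^sup>2)
                   (\<lambda>f. f \<in> L2 \<Omega>) m"
    and f: "f \<in> L2 \<Omega>"
  shows "0 \<le> \<Phi> f - \<Phi> m + L2_inner \<Omega> (\<lambda>x. m x - c x) (\<lambda>x. f x - m x) / r"
proof -
  let ?I = "L2_inner \<Omega> (\<lambda>x. m x - c x) (\<lambda>x. f x - m x)"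
  let ?Q = "L2_inner \<Omega> (\<lambda>x. f x - m x) (\<lambda>x. f x - m x)"
  have m: "m \<in> L2 \<Omega>" using argmin by (simp add: is_arg_min_def)
  have approx: "0 \<le> \<Phi> f - \<Phi> m + ?I / r + t * (?Q / (2 * r))" if t: "t \<in> {0<..<1}" for t
  proof -
    let ?h = "\<lambda>x. m x + t * (f x - m x)"
    have h: "?h \<in> L2 \<Omega>" using m f by simp
    have "\<Phi> m + 1 / (2 * r) * (L2_norm \<Omega> (\<lambda>x. m x - c x))\<^sup>2
        \<le> \<Phi> ?h + 1 / (2 * r) * (L2_norm \<Omega> (\<lambda>x. ?h x - c x))\<^sup>2"
      using argmin h by (auto simp: is_arg_min_def not_less simp del: L2_norm_power2)
    moreover have "\<Phi> ?h \<le> \<Phi> m + t * (\<Phi> f - \<Phi> m)"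
      using cvx m f t by (simp add: L2_convex_def)
    moreover have "(L2_norm \<Omega> (\<lambda>x. ?h x - c x))\<^sup>2
        = (L2_norm \<Omega> (\<lambda>x. m x - c x))\<^sup>2 + 2 * t * ?I + t * t * ?Q"
      using m f c by (simp add: L2_inner_commute[of \<Omega> f m] L2_inner_commute[of \<Omega> c m]
          L2_inner_commute[of \<Omega> c f] algebra_simps)
    ultimately have "0 \<le> t * (\<Phi> f - \<Phi> m) + 1 / (2 * r) * (2 * t * ?I + t * t * ?Q)"
      by (simp only: distrib_left)
    also have "\<dots> = t * (\<Phi> f - \<Phi> m + ?I / r + t * (?Q / (2 * r)))"
      using r by (simp add: field_simps)
    finally show ?thesis using t by (simp add: zero_le_mult_iff)
  qed
  have "((\<lambda>t. \<Phi> f - \<Phi> m + ?I / r + t * (?Q / (2 * r)))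
          \<longlongrightarrow> \<Phi> f - \<Phi> m + ?I / r + 0 * (?Q / (2 * r))) (at_right 0)"
    by (intro tendsto_intros)
  moreover have "\<forall>\<^sub>F t in at_right (0::real). t \<in> {0<..<1}"
    by (rule eventually_at_right_real) simp
  then have "\<forall>\<^sub>F t in at_right (0::real). 0 \<le> \<Phi> f - \<Phi> m + ?I / r + t * (?Q / (2 * r))"
    by (rule eventually_mono) (rule approx)
  ultimately have "0 \<le> \<Phi> f - \<Phi> m + ?I / r + 0 * (?Q / (2 * r))"
    by (rule tendsto_lowerbound) simp
  then show ?thesis by simp
qed


section \<open>The quadratic forms attached to the iteration\<close>

locale primal_dual_forms =
  fixes \<Omega> :: "'a::euclidean_space set"
    and L Ls :: "('a \<Rightarrow> real) \<Rightarrow> ('a \<Rightarrow> real)"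
    and \<theta> r s \<rho> \<sigma> :: real
  assumes maps: "f \<in> L2 \<Omega> \<Longrightarrow> L f \<in> L2 \<Omega>"
    and adj: "L2_adjoint \<Omega> L Ls"
    and steps: "0 < r" "0 < s" "0 < \<rho>" "0 < \<sigma>"
    and sigma: "\<theta> * \<sigma> = \<rho>"
begin

abbreviation pairs :: "'a W set" where
  "pairs \<equiv> L2 \<Omega> \<times> L2 \<Omega>"

abbreviation D :: "'a W \<Rightarrow> 'a W" where
  "D \<equiv> D_op \<rho> \<sigma>"

definition coupling :: "('a \<Rightarrow> real) \<Rightarrow> ('a \<Rightarrow> real) \<Rightarrow> real" where
  "coupling f q = L2_inner \<Omega> (L f) q"

definition G_form :: "'a W \<Rightarrow> 'a W \<Rightarrow> real" where
  "G_form w z = L2_inner \<Omega> (fst w) (fst z) / r - coupling (fst z) (snd w)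
     - \<theta> * coupling (fst w) (snd z) + L2_inner \<Omega> (snd w) (snd z) / s"

text \<open>
  This is \<open>(G w, D z)\<close> with \<open>\<theta> \<sigma> = \<rho>\<close> inserted, a symmetric form whose quadratic form is
  \<open>\<parallel>D w\<parallel>\<^sub>K\<^sup>2\<close>.
\<close>

definition S_form :: "'a W \<Rightarrow> 'a W \<Rightarrow> real" where
  "S_form w z = \<rho> / r * L2_inner \<Omega> (fst w) (fst z)
     - \<rho> * (coupling (fst z) (snd w) + coupling (fst w) (snd z))
     + \<sigma> / s * L2_inner \<Omega> (snd w) (snd z)"

lemma W_diff_pairs [simp]: "w \<in> pairs \<Longrightarrow> z \<in> pairs \<Longrightarrow> W_diff w z \<in> pairs"
  by (auto simp: W_diff_def)

lemma D_pairs [simp]: "w \<in> pairs \<Longrightarrow> D_op a b w \<in> pairs"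
  by (auto simp: D_op_def)

lemma coupling_adjoint: "f \<in> L2 \<Omega> \<Longrightarrow> q \<in> L2 \<Omega> \<Longrightarrow> coupling f q = L2_inner \<Omega> f (Ls q)"
  by (simp add: coupling_def L2_adjoint_inner[OF adj])

lemma Ls_L2 [simp]: "q \<in> L2 \<Omega> \<Longrightarrow> Ls q \<in> L2 \<Omega>"
  using adj by (simp add: L2_adjoint_def)

lemma coupling_linear_left [simp]:
  assumes "f \<in> L2 \<Omega>" "g \<in> L2 \<Omega>" "q \<in> L2 \<Omega>"
  shows "coupling (\<lambda>x. f x - g x) q = coupling f q - coupling g q"
    "coupling (\<lambda>x. f x + g x) q = coupling f q + coupling g q"
    "coupling (\<lambda>x. c * f x) q = c * coupling f q"
  using assms by (simp_all add: coupling_adjoint)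

lemma coupling_linear_right [simp]:
  assumes "f \<in> L2 \<Omega>" "q \<in> L2 \<Omega>" "q' \<in> L2 \<Omega>"
  shows "coupling f (\<lambda>x. q x - q' x) = coupling f q - coupling f q'"
    "coupling f (\<lambda>x. c * q x) = c * coupling f q"
  using assms by (simp_all add: coupling_def maps)

lemma coupling_cong_left:
  assumes "L2_eq \<Omega> f g" "f \<in> L2 \<Omega>" "g \<in> L2 \<Omega>" "q \<in> L2 \<Omega>"
  shows "coupling f q = coupling g q"
  using assms by (simp add: coupling_adjoint L2_inner_cong_AE[of \<Omega> f g])

lemma coupling_cong_right:
  assumes "L2_eq \<Omega> q q'" "f \<in> L2 \<Omega>" "q \<in> L2 \<Omega>" "q' \<in> L2 \<Omega>"
  shows "coupling f q = coupling f q'"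
  using assms
  by (simp add: coupling_def L2_inner_commute[of \<Omega> "L f"] L2_inner_cong_AE[of \<Omega> q q'] maps)

lemma G_form_diff_right:
  "w \<in> pairs \<Longrightarrow> z \<in> pairs \<Longrightarrow> z' \<in> pairs \<Longrightarrow> G_form w (W_diff z z') = G_form w z - G_form w z'"
  by (auto simp: G_form_def W_diff_def diff_divide_distrib algebra_simps)

lemma G_form_diff_left:
  "w \<in> pairs \<Longrightarrow> w' \<in> pairs \<Longrightarrow> z \<in> pairs \<Longrightarrow> G_form (W_diff w w') z = G_form w z - G_form w' z"
  by (auto simp: G_form_def W_diff_def diff_divide_distrib algebra_simps)

lemma S_form_diff_right:
  "w \<in> pairs \<Longrightarrow> z \<in> pairs \<Longrightarrow> z' \<in> pairs \<Longrightarrow> S_form w (W_diff z z') = S_form w z - S_form w z'"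
  by (auto simp: S_form_def W_diff_def diff_divide_distrib algebra_simps)

lemma S_form_commute: "S_form w z = S_form z w"
  by (simp add: S_form_def L2_inner_commute[of \<Omega> "fst w"] L2_inner_commute[of \<Omega> "snd w"] algebra_simps)

lemma S_form_diff_diff:
  assumes "w \<in> pairs" "z \<in> pairs"
  shows "S_form (W_diff w z) (W_diff w z) = S_form w w - 2 * S_form z w + S_form z z"
proof -
  have "S_form (W_diff w z) (W_diff w z) = S_form (W_diff w z) w - S_form (W_diff w z) z"
    using assms by (simp add: S_form_diff_right)
  also have "\<dots> = S_form w (W_diff w z) - S_form z (W_diff w z)"
    by (simp only: S_form_commute[of "W_diff w z" w] S_form_commute[of "W_diff w z" z])
  finally show ?thesis
    using assms by (simp add: S_form_diff_right S_form_commute[of w z])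
qed

lemma G_form_D:
  assumes "w \<in> pairs" "z \<in> pairs"
  shows "G_form w (D z) = S_form w z"
proof -
  have "\<theta> * (\<sigma> * x) = \<rho> * x" for x
    using sigma by (simp flip: mult.assoc)
  then show ?thesis
    using assms by (auto simp: G_form_def S_form_def D_op_def algebra_simps)
qed

lemma G_op_G_form:
  assumes "w \<in> pairs" "z \<in> pairs"
  shows "W_inner \<Omega> (G_op L Ls \<theta> r s w) z = G_form w z"
proof -
  have scale: "L2_inner \<Omega> (\<lambda>x. f x / c) h = L2_inner \<Omega> f h / c" "(\<lambda>x. f x / c) \<in> L2 \<Omega>"
    if "f \<in> L2 \<Omega>" for f h and c :: real
    using L2_inner_scale_left[of \<Omega> "1 / c" f h] L2_scale[OF that, of "1 / c"] by simp_all
  have neg: "(\<lambda>x. - (\<theta> * f x) + g x / s) = (\<lambda>x. g x / s - \<theta> * f x)" for f g :: "'a \<Rightarrow> real"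
    by auto
  show ?thesis
    using assms
    by (auto simp: W_inner_def G_op_def G_form_def scale neg maps coupling_adjoint[symmetric]
        L2_inner_commute[of \<Omega> "Ls _"]) (simp add: coupling_def)
qed

lemma D_inverse: "D (D_op (1 / \<rho>) (1 / \<sigma>) w) = w" "D_op (1 / \<rho>) (1 / \<sigma>) (D w) = w"
  using steps by (auto simp: D_op_def split: prod.splits)

lemma K_normsq_D:
  assumes "w \<in> pairs"
  shows "K_normsq \<Omega> L Ls \<theta> r s \<rho> \<sigma> (D w) = S_form w w"
proof -
  have "inv D (D w) = w"
    by (intro inv_f_f injI) (metis D_inverse(2))
  then show ?thesis
    using assms by (simp add: K_normsq_def K_op_def G_op_G_form G_form_D)
qed

text \<open>
  The perturbed optimality condition shared by all points of interest: \<open>e = w - w~\<close> for a predictor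
  \<open>w~\<close> computed from \<open>w\<close>, and \<open>e = 0\<close> for a saddle point.
\<close>

definition resolvent_inequality :: "('a W \<Rightarrow> real) \<Rightarrow> 'a W \<Rightarrow> 'a W \<Rightarrow> bool" where
  "resolvent_inequality \<Phi> wt e \<longleftrightarrow> (\<forall>z\<in>pairs.
     0 \<le> \<Phi> z - \<Phi> wt + coupling (fst z) (snd wt) - coupling (fst wt) (snd z)
         - G_form e (W_diff z wt))"

text \<open>
  When the solution of each inequality is inserted as the comparison point of the other, the values
  of \<open>\<Phi>\<close> and the skew-symmetric coupling terms cancel. This is the monotonicity of the saddle point
  operator.
\<close>

lemma resolvent_monotone:
  assumes "resolvent_inequality \<Phi> wt e" "resolvent_inequality \<Phi> wt' e'"
    and mem: "wt \<in> pairs" "wt' \<in> pairs" "e \<in> pairs" "e' \<in> pairs"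
  shows "0 \<le> G_form (W_diff e e') (W_diff wt wt')"
proof -
  have "0 \<le> \<Phi> wt' - \<Phi> wt + coupling (fst wt') (snd wt) - coupling (fst wt) (snd wt')
         - G_form e (W_diff wt' wt)"
    "0 \<le> \<Phi> wt - \<Phi> wt' + coupling (fst wt) (snd wt') - coupling (fst wt') (snd wt)
         - G_form e' (W_diff wt wt')"
    using assms by (auto simp: resolvent_inequality_def)
  then show ?thesis
    using mem by (simp add: G_form_diff_right G_form_diff_left)
qed

definition W_eq :: "'a W \<Rightarrow> 'a W \<Rightarrow> bool" where
  "W_eq w z \<longleftrightarrow> L2_eq \<Omega> (fst w) (fst z) \<and> L2_eq \<Omega> (snd w) (snd z)"

lemma G_form_cong_right:
  assumes "W_eq z z'" "w \<in> pairs" "z \<in> pairs" "z' \<in> pairs"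
  shows "G_form w z = G_form w z'"
  using assms
  by (auto simp: G_form_def W_eq_def L2_inner_commute[of \<Omega> "fst w"] L2_inner_commute[of \<Omega> "snd w"]
      L2_inner_cong_AE[of \<Omega> "fst z" "fst z'"] L2_inner_cong_AE[of \<Omega> "snd z" "snd z'"]
      coupling_cong_left[of "fst z" "fst z'"] coupling_cong_right[of "snd z" "snd z'"]
      mem_Times_iff)

lemma S_form_cong_right:
  assumes "W_eq z z'" "w \<in> pairs" "z \<in> pairs" "z' \<in> pairs"
  shows "S_form w z = S_form w z'"
  using assms
  by (auto simp: S_form_def W_eq_def L2_inner_commute[of \<Omega> "fst w"] L2_inner_commute[of \<Omega> "snd w"]
      L2_inner_cong_AE[of \<Omega> "fst z" "fst z'"] L2_inner_cong_AE[of \<Omega> "snd z" "snd z'"]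
      coupling_cong_left[of "fst z" "fst z'"] coupling_cong_right[of "snd z" "snd z'"]
      mem_Times_iff)

lemma S_form_cong:
  assumes "W_eq z z'" "z \<in> pairs" "z' \<in> pairs"
  shows "S_form z z = S_form z' z'"
  using S_form_cong_right[OF assms(1) assms(2) assms(2,3)]
    S_form_cong_right[OF assms(1) assms(3) assms(2,3)] S_form_commute[of z z'] by simp

text \<open>
  The sum of the two proximal variational inequalities. The primal step uses the old \<open>p\<^sup>k\<close> and the
  dual step the extrapolated point instead of the new predictors; the two off-diagonal entries of
  \<open>G\<close> account for exactly these two deviations.
\<close>

lemma primal_dual_resolvent_inequality:
  assumes cvx: "L2_convex \<Omega> (g_fun \<Omega> \<tau> \<beta>)" and uT: "uT \<in> L2 \<Omega>"
    and iter: "primal_dual_iteration \<Omega> \<tau> \<beta> uT L \<theta> r s \<rho> \<sigma> u p ut pt"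
  shows "resolvent_inequality (\<lambda>z. g_fun \<Omega> \<tau> \<beta> (fst z) + f_conj \<Omega> uT (snd z))
    (ut k, pt k) (W_diff (u k, p k) (ut k, pt k))"
  unfolding resolvent_inequality_def
proof
  fix z
  assume z: "z \<in> pairs"
  obtain f q where [simp]: "z = (f, q)" by (cases z)
  have [simp]: "f \<in> L2 \<Omega>" "q \<in> L2 \<Omega>" using z by auto
  let ?ub = "\<lambda>x. ut k x + \<theta> * (ut k x - u k x)"
  have [simp]: "u k \<in> L2 \<Omega>" "p k \<in> L2 \<Omega>" "ut k \<in> L2 \<Omega>" "pt k \<in> L2 \<Omega>"
    using iter by (simp_all add: primal_dual_iteration_def is_arg_min_def is_arg_max_def)
  have ub: "?ub \<in> L2 \<Omega>" by simp
  have couple: "L2_inner \<Omega> q' (L f') = coupling f' q'" for f' q'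
    by (simp add: coupling_def L2_inner_commute)
  have argmin: "is_arg_min
      (\<lambda>f. (g_fun \<Omega> \<tau> \<beta> f + coupling f (p k)) + 1 / (2 * r) * (L2_norm \<Omega> (\<lambda>x. f x - u k x))\<^sup>2)
      (\<lambda>f. f \<in> L2 \<Omega>) (ut k)"
    using iter unfolding primal_dual_iteration_def L2_inner_real[symmetric] couple by blast
  have "L2_convex \<Omega> (\<lambda>f. coupling f (p k))"
    by (simp add: L2_convex_def)
  then have primal: "0 \<le> (g_fun \<Omega> \<tau> \<beta> f + coupling f (p k)) - (g_fun \<Omega> \<tau> \<beta> (ut k) + coupling (ut k) (p k))
      + L2_inner \<Omega> (\<lambda>x. ut k x - u k x) (\<lambda>x. f x - ut k x) / r"
    by (rule proximal_step_variational_inequality[OF L2_convex_add[OF cvx] _ steps(1) argmin]) simp_all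
  have "is_arg_max
      (\<lambda>q. coupling ?ub q - f_conj \<Omega> uT q - 1 / (2 * s) * (L2_norm \<Omega> (\<lambda>x. q x - p k x))\<^sup>2)
      (\<lambda>q. q \<in> L2 \<Omega>) (pt k)"
    using iter unfolding primal_dual_iteration_def L2_inner_real[symmetric] couple by blast
  then have argmax: "is_arg_min
      (\<lambda>q. (f_conj \<Omega> uT q + (- 1) * coupling ?ub q) + 1 / (2 * s) * (L2_norm \<Omega> (\<lambda>x. q x - p k x))\<^sup>2)
      (\<lambda>q. q \<in> L2 \<Omega>) (pt k)"
    unfolding is_arg_max_def is_arg_min_def by (auto simp: algebra_simps)
  have "L2_convex \<Omega> (\<lambda>q. (- 1) * coupling ?ub q)"
    unfolding L2_convex_def
  proof (intro ballI)
    fix q q' :: "'a \<Rightarrow> real" and t :: real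
    assume "q \<in> L2 \<Omega>" "q' \<in> L2 \<Omega>"
    then have "coupling ?ub (\<lambda>x. q x + t * (q' x - q x))
        = coupling ?ub q + t * (coupling ?ub q' - coupling ?ub q)"
      using maps[OF ub] by (simp add: coupling_def)
    then show "(- 1) * coupling ?ub (\<lambda>x. q x + t * (q' x - q x))
        \<le> (- 1) * coupling ?ub q + t * ((- 1) * coupling ?ub q' - (- 1) * coupling ?ub q)"
      by (simp only:) (simp add: algebra_simps)
  qed
  then have dual: "0 \<le> (f_conj \<Omega> uT q + (- 1) * coupling ?ub q)
      - (f_conj \<Omega> uT (pt k) + (- 1) * coupling ?ub (pt k))
      + L2_inner \<Omega> (\<lambda>x. pt k x - p k x) (\<lambda>x. q x - pt k x) / s"
    by (rule proximal_step_variational_inequality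
        [OF L2_convex_add[OF L2_convex_f_conj[OF uT]] _ steps(2) argmax]) simp_all
  have flip: "L2_inner \<Omega> (\<lambda>x. a x - b x) h = - L2_inner \<Omega> (\<lambda>x. b x - a x) h"
    if "a \<in> L2 \<Omega>" "b \<in> L2 \<Omega>" "h \<in> L2 \<Omega>" for a b h :: "'a \<Rightarrow> real"
    using that by simp
  have G: "G_form (W_diff (u k, p k) (ut k, pt k)) (W_diff z (ut k, pt k))
      = - (L2_inner \<Omega> (\<lambda>x. ut k x - u k x) (\<lambda>x. f x - ut k x) / r)
        - (L2_inner \<Omega> (\<lambda>x. pt k x - p k x) (\<lambda>x. q x - pt k x) / s)
        - (coupling f (p k) - coupling f (pt k) - coupling (ut k) (p k) + coupling (ut k) (pt k))
        - \<theta> * (coupling (u k) q - coupling (u k) (pt k) - coupling (ut k) q + coupling (ut k) (pt k))"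
    using flip[of "u k" "ut k" "\<lambda>x. f x - ut k x"] flip[of "p k" "pt k" "\<lambda>x. q x - pt k x"]
    by (simp add: G_form_def W_diff_def del: L2_inner_diff_left L2_inner_diff_right)
  have ub_coupling:
    "coupling ?ub q' = coupling (ut k) q' + \<theta> * (coupling (ut k) q' - coupling (u k) q')"
    if "q' \<in> L2 \<Omega>" for q'
    using that by simp
  note dual' = dual[unfolded ub_coupling[OF \<open>q \<in> L2 \<Omega>\<close>] ub_coupling[OF \<open>pt k \<in> L2 \<Omega>\<close>]]
  show "0 \<le> (g_fun \<Omega> \<tau> \<beta> (fst z) + f_conj \<Omega> uT (snd z))
      - (g_fun \<Omega> \<tau> \<beta> (fst (ut k, pt k)) + f_conj \<Omega> uT (snd (ut k, pt k)))
      + coupling (fst z) (snd (ut k, pt k)) - coupling (fst (ut k, pt k)) (snd z)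
      - G_form (W_diff (u k, p k) (ut k, pt k)) (W_diff z (ut k, pt k))"
    using primal dual' G unfolding \<open>z = (f, q)\<close> fst_conv snd_conv
    by (simp only: right_diff_distrib distrib_left)
qed

lemma saddle_point_resolvent_inequality:
  assumes saddle: "saddle_point \<Omega> \<tau> \<beta> uT L ws"
  shows "resolvent_inequality (\<lambda>z. g_fun \<Omega> \<tau> \<beta> (fst z) + f_conj \<Omega> uT (snd z)) ws (W_diff ws ws)"
  unfolding resolvent_inequality_def
proof
  fix z
  assume z: "z \<in> pairs"
  obtain us ps where [simp]: "ws = (us, ps)" by (cases ws)
  have ws: "ws \<in> pairs" using saddle by (simp add: saddle_point_def)
  have couple: "(LINT x|lebesgue_on \<Omega>. q' x * L f' x) = coupling f' q'" for f' q'
    by (simp add: coupling_def L2_inner_real mult.commute)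
  have "saddle_fun \<Omega> \<tau> \<beta> uT L us (snd z) \<le> saddle_fun \<Omega> \<tau> \<beta> uT L us ps"
    "saddle_fun \<Omega> \<tau> \<beta> uT L us ps \<le> saddle_fun \<Omega> \<tau> \<beta> uT L (fst z) ps"
    using saddle z by (auto simp: saddle_point_def)
  moreover have "G_form (W_diff ws ws) (W_diff z ws) = 0"
    using G_form_diff_left[of ws ws "W_diff z ws"] ws z by simp
  ultimately show "0 \<le> (g_fun \<Omega> \<tau> \<beta> (fst z) + f_conj \<Omega> uT (snd z))
      - (g_fun \<Omega> \<tau> \<beta> (fst ws) + f_conj \<Omega> uT (snd ws))
      + coupling (fst z) (snd ws) - coupling (fst ws) (snd z)
      - G_form (W_diff ws ws) (W_diff z ws)"
    unfolding saddle_fun_def couple by simp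
qed

end


section \<open>Coercivity under the parameter conditions\<close>

text \<open>
  Write \<open>a = 1 + \<theta> - \<rho>\<close>, so that \<open>2 - \<rho> = a + (1 - \<theta>)\<close> and \<open>\<theta> (2 - \<sigma>) = a - (1 - \<theta>)\<close>. The form
  \<open>2 G - S\<close> has diagonal entries \<open>2 - \<rho>\<close>, \<open>2 - \<sigma>\<close> and off-diagonal entry \<open>- a\<close>, and
  \<open>a\<^sup>2 \<le> (2 - \<rho>) (2 - \<sigma>)\<close> is, after multiplication by \<open>\<theta>\<close>, just \<open>(1 - \<theta>)\<^sup>2 \<le> (1 - \<theta>) a\<^sup>2\<close>. That is
  the source of the bound \<open>\<rho> \<le> 1 + \<theta> - sqrt (1 - \<theta>)\<close>. The factor \<open>\<kappa> < 1\<close> in the coupling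
  turns the resulting semidefiniteness into coercivity:
  \<open>2 G - S \<ge> (1 - \<kappa>) min (2 - \<rho>) (2 - \<sigma>) (X\<^sup>2 + Y\<^sup>2)\<close>, and \<open>S \<le> 2 \<sigma> (X\<^sup>2 + Y\<^sup>2)\<close>. Here \<open>X\<close>, \<open>Y\<close> and \<open>c\<close>
  stand for the norms of the two components, divided by \<open>sqrt r\<close> and \<open>sqrt s\<close>, and for their coupling.
\<close>

lemma relaxation_coercive:
  fixes X Y c \<theta> \<rho> \<sigma> \<kappa> :: real
  defines "a \<equiv> 1 + \<theta> - \<rho>"
  assumes theta: "0 < \<theta>" "\<theta> \<le> 1" and rho: "0 < \<rho>" and sigma: "\<sigma> = \<rho> / \<theta>"
    and a: "1 - \<theta> \<le> a\<^sup>2" "1 - \<theta> < a"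
    and kappa: "0 \<le> \<kappa>" "\<kappa> < 1" and c: "\<bar>c\<bar> \<le> \<kappa> * (X * Y)" and XY: "0 \<le> X" "0 \<le> Y"
    and S: "S = \<rho> * X\<^sup>2 + \<sigma> * Y\<^sup>2 - 2 * \<rho> * c"
    and G: "G = X\<^sup>2 + Y\<^sup>2 - (1 + \<theta>) * c"
  shows "0 \<le> S"
    and "0 < (1 - \<kappa>) * min (2 - \<rho>) (2 - \<sigma>) / (2 * \<sigma>)"
    and "(1 - \<kappa>) * min (2 - \<rho>) (2 - \<sigma>) / (2 * \<sigma>) * S \<le> 2 * G - S"
proof -
  define P where "P = 2 - \<rho>"
  define Q where "Q = 2 - \<sigma>"
  have P: "P = a + (1 - \<theta>)" by (simp add: P_def a_def)
  have Q: "\<theta> * Q = a - (1 - \<theta>)"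
    using theta by (simp add: Q_def a_def sigma field_simps)
  have a0: "0 < a" using a theta by linarith
  have P0: "0 < P" using P a theta by linarith
  have "0 < \<theta> * Q" using Q a by linarith
  then have Q0: "0 < Q" using theta by (simp add: zero_less_mult_iff)
  have rs: "\<rho> \<le> \<sigma>" using theta rho by (simp add: sigma field_simps mult_left_le)
  have am: "2 * (X * Y) \<le> X\<^sup>2 + Y\<^sup>2" using sum_squares_bound[of X Y] by (simp add: mult.assoc)
  have XY0: "0 \<le> X * Y" using XY by simp
  have "\<kappa> * (X * Y) \<le> X * Y" using kappa XY0 mult_right_mono[of \<kappa> 1 "X * Y"] by simp
  then have c2: "2 * \<bar>c\<bar> \<le> X\<^sup>2 + Y\<^sup>2" using c am by linarith
  have rc: "\<bar>2 * \<rho> * c\<bar> \<le> \<rho> * (X\<^sup>2 + Y\<^sup>2)"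
    using mult_left_mono[OF c2, of \<rho>] rho by (simp add: abs_mult)
  have rsY: "\<rho> * Y\<^sup>2 \<le> \<sigma> * Y\<^sup>2" and rsX: "\<rho> * X\<^sup>2 \<le> \<sigma> * X\<^sup>2"
    using rs by (simp_all add: mult_right_mono)
  show "0 \<le> S" using rc rsY unfolding S distrib_left by linarith
  have S_le: "S \<le> 2 * \<sigma> * (X\<^sup>2 + Y\<^sup>2)"
    using rc rsX rsY unfolding S distrib_left by linarith
  let ?m = "min P Q"
  show "0 < (1 - \<kappa>) * min (2 - \<rho>) (2 - \<sigma>) / (2 * \<sigma>)"
    using kappa P0 Q0 rs rho unfolding P_def Q_def by simp
  have "(1 - \<theta>) * (1 - \<theta>) \<le> (1 - \<theta>) * a\<^sup>2"
    using a theta by (intro mult_left_mono) auto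
  then have "\<theta> * a\<^sup>2 \<le> (a + (1 - \<theta>)) * (a - (1 - \<theta>))"
    by (simp add: power2_eq_square algebra_simps)
  then have "\<theta> * a\<^sup>2 \<le> \<theta> * (P * Q)"
    unfolding P Q[symmetric] by (simp add: mult_ac)
  then have "a\<^sup>2 \<le> P * Q" using theta by simp
  then have "sqrt (a\<^sup>2) \<le> sqrt (P * Q)" by (rule real_sqrt_le_mono)
  then have a_le: "a \<le> sqrt P * sqrt Q" using a0 by (simp add: real_sqrt_mult)
  have "2 * (a * (X * Y)) \<le> 2 * (sqrt P * sqrt Q * (X * Y))"
    using mult_right_mono[OF a_le XY0] by simp
  also have "\<dots> = 2 * (sqrt P * X) * (sqrt Q * Y)" by simp
  also have "\<dots> \<le> (sqrt P * X)\<^sup>2 + (sqrt Q * Y)\<^sup>2" by (rule sum_squares_bound)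
  also have "\<dots> = P * X\<^sup>2 + Q * Y\<^sup>2" using P0 Q0 by (simp add: power_mult_distrib)
  finally have aXY: "2 * (a * (X * Y)) \<le> P * X\<^sup>2 + Q * Y\<^sup>2" .
  have "2 * (a * c) \<le> 2 * (a * (\<kappa> * (X * Y)))"
    using c a0 by simp
  also have "\<dots> = \<kappa> * (2 * (a * (X * Y)))" by simp
  also have "\<dots> \<le> \<kappa> * (P * X\<^sup>2 + Q * Y\<^sup>2)" by (rule mult_left_mono[OF aXY kappa(1)])
  finally have ac: "2 * (a * c) \<le> \<kappa> * (P * X\<^sup>2 + Q * Y\<^sup>2)" .
  have GS: "2 * G - S = P * X\<^sup>2 + Q * Y\<^sup>2 - 2 * (a * c)"
    by (simp add: G S P_def Q_def a_def algebra_simps)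
  have "(1 - \<kappa>) * ?m / (2 * \<sigma>) * S \<le> (1 - \<kappa>) * ?m / (2 * \<sigma>) * (2 * \<sigma> * (X\<^sup>2 + Y\<^sup>2))"
    using kappa P0 Q0 rs rho S_le by (intro mult_left_mono) auto
  also have "\<dots> = (1 - \<kappa>) * (?m * X\<^sup>2 + ?m * Y\<^sup>2)"
    using rs rho by (simp add: distrib_left)
  also have "\<dots> \<le> (1 - \<kappa>) * (P * X\<^sup>2 + Q * Y\<^sup>2)"
    using kappa by (intro mult_left_mono add_mono mult_right_mono) auto
  also have "\<dots> \<le> 2 * G - S" using ac unfolding GS left_diff_distrib by simp
  finally show "(1 - \<kappa>) * min (2 - \<rho>) (2 - \<sigma>) / (2 * \<sigma>) * S \<le> 2 * G - S"
    unfolding P_def Q_def .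
qed

context primal_dual_forms
begin

lemma coupling_bound:
  assumes bl: "L2_bounded_linear \<Omega> L" and "f \<in> L2 \<Omega>" "q \<in> L2 \<Omega>"
  shows "\<bar>coupling f q\<bar> \<le> sqrt (r * s * L2_onorm \<Omega> (L \<circ> Ls))
           * (L2_norm \<Omega> f / sqrt r * (L2_norm \<Omega> q / sqrt s))"
proof -
  have "\<bar>coupling f q\<bar> \<le> L2_norm \<Omega> f * L2_norm \<Omega> (Ls q)"
    using assms by (simp add: coupling_adjoint L2_Cauchy_Schwarz)
  also have "\<dots> \<le> L2_norm \<Omega> f * (sqrt (L2_onorm \<Omega> (L \<circ> Ls)) * L2_norm \<Omega> q)"
    using L2_norm_adjoint_le[OF bl adj] assms by (intro mult_left_mono) simp_all
  also have "\<dots> = sqrt (r * s * L2_onorm \<Omega> (L \<circ> Ls))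
           * (L2_norm \<Omega> f / sqrt r * (L2_norm \<Omega> q / sqrt s))"
    using steps by (simp add: real_sqrt_mult)
  finally show ?thesis .
qed

lemma S_form_coercive:
  fixes \<kappa> :: real
  assumes theta: "0 < \<theta>" "\<theta> \<le> 1"
    and a: "1 - \<theta> \<le> (1 + \<theta> - \<rho>)\<^sup>2" "1 - \<theta> < 1 + \<theta> - \<rho>"
    and bl: "L2_bounded_linear \<Omega> L"
    and kappa: "\<kappa> = sqrt (r * s * L2_onorm \<Omega> (L \<circ> Ls))" "0 \<le> \<kappa>" "\<kappa> < 1"
    and e: "e \<in> pairs"
  shows "0 \<le> S_form e e"
    and "(1 - \<kappa>) * min (2 - \<rho>) (2 - \<sigma>) / (2 * \<sigma>) * S_form e e \<le> 2 * G_form e e - S_form e e"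
    and "0 < (1 - \<kappa>) * min (2 - \<rho>) (2 - \<sigma>) / (2 * \<sigma>)"
proof -
  let ?X = "L2_norm \<Omega> (fst e) / sqrt r" and ?Y = "L2_norm \<Omega> (snd e) / sqrt s"
  have mem: "fst e \<in> L2 \<Omega>" "snd e \<in> L2 \<Omega>" using e by auto
  have sigma': "\<sigma> = \<rho> / \<theta>" using sigma theta by (simp add: field_simps)
  have sq: "?X\<^sup>2 = L2_inner \<Omega> (fst e) (fst e) / r" "?Y\<^sup>2 = L2_inner \<Omega> (snd e) (snd e) / s"
    using steps by (simp_all add: power_divide)
  have S: "S_form e e = \<rho> * ?X\<^sup>2 + \<sigma> * ?Y\<^sup>2 - 2 * \<rho> * coupling (fst e) (snd e)"
    unfolding S_form_def sq by simp
  have G: "G_form e e = ?X\<^sup>2 + ?Y\<^sup>2 - (1 + \<theta>) * coupling (fst e) (snd e)"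
    unfolding G_form_def sq by (simp add: algebra_simps)
  have "0 \<le> ?X" "0 \<le> ?Y" using steps by simp_all
  note * = relaxation_coercive[OF theta steps(3) sigma' a kappa(2,3)
      coupling_bound[OF bl mem, folded kappa(1)] this S G]
  show "0 \<le> S_form e e"
    "(1 - \<kappa>) * min (2 - \<rho>) (2 - \<sigma>) / (2 * \<sigma>) * S_form e e \<le> 2 * G_form e e - S_form e e"
    "0 < (1 - \<kappa>) * min (2 - \<rho>) (2 - \<sigma>) / (2 * \<sigma>)"
    using * by simp_all
qed


section \<open>Fejer monotonicity and the rate of convergence\<close>

context
  fixes \<Phi> :: "'a W \<Rightarrow> real" and w wt :: "nat \<Rightarrow> 'a W" and ws :: "'a W" and c0 :: real
  assumes mem: "\<And>k. w k \<in> pairs" "\<And>k. wt k \<in> pairs" "ws \<in> pairs"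
    and relax: "\<And>k. W_eq (w (Suc k)) (W_diff (w k) (D (W_diff (w k) (wt k))))"
    and predictor: "\<And>k. resolvent_inequality \<Phi> (wt k) (W_diff (w k) (wt k))"
    and solution: "resolvent_inequality \<Phi> ws (W_diff ws ws)"
    and S_nonneg: "\<And>e. e \<in> pairs \<Longrightarrow> 0 \<le> S_form e e"
    and c0: "0 < c0"
    and coercive: "\<And>e. e \<in> pairs \<Longrightarrow> c0 * S_form e e \<le> 2 * G_form e e - S_form e e"
begin

text \<open>The quadratic form of \<open>S\<close> at this rescaled error is \<open>\<parallel>w\<^sup>k - w\<^sup>*\<parallel>\<^sub>K\<^sup>2\<close>.\<close>

definition scaled_error :: "nat \<Rightarrow> 'a W" where
  "scaled_error k = D_op (1 / \<rho>) (1 / \<sigma>) (W_diff (w k) ws)"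

definition residual :: "nat \<Rightarrow> 'a W" where
  "residual k = W_diff (w k) (wt k)"

lemma scaled_error_pairs [simp]: "scaled_error k \<in> pairs"
  using mem by (simp add: scaled_error_def)

lemma residual_pairs [simp]: "residual k \<in> pairs"
  using mem by (simp add: residual_def)

lemma D_scaled_error: "D (scaled_error k) = W_diff (w k) ws"
  by (simp add: scaled_error_def D_inverse)

lemma relax_AE:
  "AE x in lebesgue_on \<Omega>. fst (w (Suc k)) x = fst (w k) x - \<rho> * (fst (w k) x - fst (wt k) x)"
  "AE x in lebesgue_on \<Omega>. snd (w (Suc k)) x = snd (w k) x - \<sigma> * (snd (w k) x - snd (wt k) x)"
  using relax[of k] by (simp_all add: W_eq_def L2_eq_def W_diff_def D_op_def split: prod.splits)

lemma scaled_error_Suc: "W_eq (scaled_error (Suc k)) (W_diff (scaled_error k) (residual k))"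
proof -
  have "AE x in lebesgue_on \<Omega>. 1 / \<rho> * (fst (w (Suc k)) x - fst ws x)
      = 1 / \<rho> * (fst (w k) x - fst ws x) - (fst (w k) x - fst (wt k) x)"
    using relax_AE(1)[of k] by eventually_elim (use steps in \<open>simp add: field_simps\<close>)
  moreover have "AE x in lebesgue_on \<Omega>. 1 / \<sigma> * (snd (w (Suc k)) x - snd ws x)
      = 1 / \<sigma> * (snd (w k) x - snd ws x) - (snd (w k) x - snd (wt k) x)"
    using relax_AE(2)[of k] by eventually_elim (use steps in \<open>simp add: field_simps\<close>)
  ultimately show ?thesis
    by (simp add: W_eq_def L2_eq_def scaled_error_def residual_def W_diff_def D_op_def)
qed

text \<open>
  With \<open>y\<close> the rescaled error and \<open>e\<close> the residual, the correction step turns \<open>y\<close> into \<open>y - e\<close>, while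
  monotonicity between the predictor and the solution says \<open>G(e,e) \<le> S(e,y)\<close>. So the decrease of
  \<open>S(y,y)\<close> is at least \<open>2 G(e,e) - S(e,e)\<close>.
\<close>

lemma Fejer_descent:
  "c0 * S_form (residual k) (residual k)
     \<le> S_form (scaled_error k) (scaled_error k) - S_form (scaled_error (Suc k)) (scaled_error (Suc k))"
proof -
  let ?y = "scaled_error k" and ?e = "residual k"
  have "0 \<le> G_form (W_diff ?e (W_diff ws ws)) (W_diff (wt k) ws)"
    using resolvent_monotone[OF predictor solution] mem by (simp add: residual_def)
  then have "0 \<le> G_form ?e (W_diff (wt k) ws)"
    using mem by (simp add: G_form_diff_left)
  also have "W_diff (wt k) ws = W_diff (D ?y) ?e"
    by (simp add: D_scaled_error residual_def W_diff_def)
  finally have "G_form ?e ?e \<le> S_form ?e ?y"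
    by (simp add: G_form_diff_right G_form_D)
  moreover have "S_form (scaled_error (Suc k)) (scaled_error (Suc k))
      = S_form ?y ?y - 2 * S_form ?e ?y + S_form ?e ?e"
    using S_form_cong[OF scaled_error_Suc] by (simp add: S_form_diff_diff)
  ultimately show ?thesis using coercive[of ?e] by simp
qed

text \<open>
  The same computation with two consecutive predictors in place of predictor and solution, and
  with the change \<open>\<delta>\<close> of the residual in place of the residual.
\<close>

lemma residual_antimono: "S_form (residual (Suc k)) (residual (Suc k)) \<le> S_form (residual k) (residual k)"
proof -
  let ?e = "residual k"
  define \<delta> where "\<delta> = W_diff ?e (residual (Suc k))"
  have \<delta>: "\<delta> \<in> pairs" by (simp add: \<delta>_def)
  have "AE x in lebesgue_on \<Omega>. fst (wt k) x - fst (wt (Suc k)) x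
      = \<rho> * (fst (w k) x - fst (wt k) x)
        - ((fst (w k) x - fst (wt k) x) - (fst (w (Suc k)) x - fst (wt (Suc k)) x))"
    using relax_AE(1)[of k] by eventually_elim simp
  moreover have "AE x in lebesgue_on \<Omega>. snd (wt k) x - snd (wt (Suc k)) x
      = \<sigma> * (snd (w k) x - snd (wt k) x)
        - ((snd (w k) x - snd (wt k) x) - (snd (w (Suc k)) x - snd (wt (Suc k)) x))"
    using relax_AE(2)[of k] by eventually_elim simp
  ultimately have eq: "W_eq (W_diff (wt k) (wt (Suc k))) (W_diff (D ?e) \<delta>)"
    by (simp add: W_eq_def L2_eq_def residual_def \<delta>_def W_diff_def D_op_def)
  have "0 \<le> G_form \<delta> (W_diff (wt k) (wt (Suc k)))"
    using resolvent_monotone[OF predictor predictor] mem by (simp add: residual_def \<delta>_def)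
  also have "\<dots> = G_form \<delta> (W_diff (D ?e) \<delta>)"
    using \<delta> mem by (intro G_form_cong_right[OF eq]) simp_all
  finally have "G_form \<delta> \<delta> \<le> S_form \<delta> ?e"
    using \<delta> by (simp add: G_form_diff_right G_form_D)
  moreover have "residual (Suc k) = W_diff ?e \<delta>"
    by (simp add: \<delta>_def W_diff_def)
  then have "S_form (residual (Suc k)) (residual (Suc k))
      = S_form ?e ?e - 2 * S_form \<delta> ?e + S_form \<delta> \<delta>"
    using \<delta> by (simp add: S_form_diff_diff)
  moreover have "0 \<le> 2 * G_form \<delta> \<delta> - S_form \<delta> \<delta>"
    using coercive[OF \<delta>] S_nonneg[OF \<delta>] c0 by (meson mult_nonneg_nonneg less_imp_le order_trans)
  ultimately show ?thesis by linarith
qed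

text \<open>
  Summing the descent inequalities bounds \<open>c0\<close> times the sum of the first \<open>K + 1\<close> values \<open>S(e,e)\<close> by the
  initial error, and the last of them is the smallest.
\<close>

lemma residual_rate:
  "K_normsq \<Omega> L Ls \<theta> r s \<rho> \<sigma> (D (W_diff (w K) (wt K)))
     \<le> 1 / (c0 * (real K + 1)) * K_normsq \<Omega> L Ls \<theta> r s \<rho> \<sigma> (W_diff (w 0) ws)"
proof -
  let ?R = "\<lambda>k. S_form (residual k) (residual k)"
  let ?E = "\<lambda>k. S_form (scaled_error k) (scaled_error k)"
  have anti: "?R K \<le> ?R k" if "k \<le> K" for k
    using lift_Suc_antimono_le[of ?R, OF residual_antimono that] .
  have "c0 * (real K + 1) * ?R K = (\<Sum>k<Suc K. c0 * ?R K)"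
    by (simp add: algebra_simps)
  also have "\<dots> \<le> (\<Sum>k<Suc K. c0 * ?R k)"
    using c0 by (intro sum_mono mult_left_mono anti) auto
  also have "\<dots> \<le> (\<Sum>k<Suc K. ?E k - ?E (Suc k))"
    by (intro sum_mono Fejer_descent)
  also have "\<dots> = ?E 0 - ?E (Suc K)"
    by (rule sum_lessThan_telescope')
  also have "\<dots> \<le> ?E 0"
    using S_nonneg[OF scaled_error_pairs] by simp
  finally have "c0 * (real K + 1) * ?R K \<le> ?E 0" .
  moreover have "0 < c0 * (real K + 1)" using c0 by simp
  ultimately have "?R K \<le> 1 / (c0 * (real K + 1)) * ?E 0"
    by (simp add: pos_le_divide_eq mult.commute)
  then show ?thesis
    using K_normsq_D[of "residual K"] K_normsq_D[of "scaled_error 0"]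
    by (simp add: D_scaled_error residual_def mem)
qed

end

end


section \<open>Sublinear convergence of the generalized primal-dual algorithm\<close>

theorem theorem4p6:
  fixes \<Omega> :: "'a::euclidean_space set"
    and v :: 'a
    and T d \<tau> \<beta> \<theta> r s \<rho> \<sigma> :: real
    and uT :: "'a \<Rightarrow> real"
    and L Ls :: "('a \<Rightarrow> real) \<Rightarrow> ('a \<Rightarrow> real)"
    and u p ut pt :: "nat \<Rightarrow> 'a \<Rightarrow> real"
    and us ps :: "'a \<Rightarrow> real"
  assumes domain: "open \<Omega>" "connected \<Omega>" "\<Omega> \<noteq> {}" "bounded \<Omega>"
    and params: "0 < T" "0 < d" "0 < \<tau>" "0 < \<beta>"
    and uT: "uT \<in> L2 \<Omega>"
    and L: "solution_operator \<Omega> d v T L" "L2_bounded_linear \<Omega> L"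
    and Ls: "L2_adjoint \<Omega> L Ls"
    and theta: "0 < \<theta>" "\<theta> \<le> 1"
    and rs: "0 < r" "0 < s" "r * s < 1 / L2_onorm \<Omega> (L \<circ> Ls)"
    and rho_sigma1: "\<theta> = 1 \<Longrightarrow> \<rho> = \<sigma> \<and> \<rho> \<in> {0<..<2}"
    and rho_sigma2: "\<theta> < 1 \<Longrightarrow> \<rho> \<in> {0<..1 + \<theta> - sqrt (1 - \<theta>)} \<and> \<sigma> = \<rho> / \<theta>"
    and iter: "primal_dual_iteration \<Omega> \<tau> \<beta> uT L \<theta> r s \<rho> \<sigma> u p ut pt"
    and saddle: "saddle_point \<Omega> \<tau> \<beta> uT L (us, ps)"
  shows "\<exists>c0>0. \<forall>K::nat.
    K_normsq \<Omega> L Ls \<theta> r s \<rho> \<sigma> (D_op \<rho> \<sigma> (W_diff (u K, p K) (ut K, pt K)))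
    \<le> 1 / (c0 * (real K + 1)) * K_normsq \<Omega> L Ls \<theta> r s \<rho> \<sigma> (W_diff (u 0, p 0) (us, ps))"
proof -
  \<comment> \<open>For \<open>\<parallel>L L\<^sup>*\<parallel> = 0\<close> the quotient \<open>1 / 0 = 0\<close> is not above \<open>r s\<close>, so the step size condition excludes it.\<close>
  have onorm_pos: "0 < L2_onorm \<Omega> (L \<circ> Ls)"
  proof (rule ccontr)
    assume "\<not> 0 < L2_onorm \<Omega> (L \<circ> Ls)"
    then have "1 / L2_onorm \<Omega> (L \<circ> Ls) \<le> 0" by (simp add: divide_le_0_iff)
    then show False using rs mult_pos_pos[OF rs(1,2)] by linarith
  qed
  define \<kappa> where "\<kappa> = sqrt (r * s * L2_onorm \<Omega> (L \<circ> Ls))"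
  have "r * s * L2_onorm \<Omega> (L \<circ> Ls) < 1"
    using rs(3) onorm_pos by (simp add: field_simps)
  then have kappa: "0 \<le> \<kappa>" "\<kappa> < 1"
    using rs onorm_pos by (simp_all add: \<kappa>_def)
  have relaxation: "0 < \<rho>" "\<theta> * \<sigma> = \<rho>" "1 - \<theta> \<le> (1 + \<theta> - \<rho>)\<^sup>2" "1 - \<theta> < 1 + \<theta> - \<rho>"
  proof -
    consider "\<theta> = 1" | "\<theta> < 1" using theta by linarith
    then have "0 < \<rho> \<and> \<theta> * \<sigma> = \<rho> \<and> 1 - \<theta> \<le> (1 + \<theta> - \<rho>)\<^sup>2 \<and> 1 - \<theta> < 1 + \<theta> - \<rho>"
    proof cases
      case 1
      then show ?thesis using rho_sigma1 by simp
    next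
      case 2
      let ?q = "sqrt (1 - \<theta>)"
      have q: "?q \<le> 1 + \<theta> - \<rho>" "0 < ?q" "?q\<^sup>2 = 1 - \<theta>"
        using rho_sigma2 2 by auto
      have "?q\<^sup>2 \<le> (1 + \<theta> - \<rho>)\<^sup>2"
        using q by (intro power_mono) auto
      moreover have "?q < 1" using theta by simp
      from mult_strict_left_mono[OF this q(2)] have "?q\<^sup>2 < ?q"
        by (simp only: power2_eq_square mult_1_right)
      then have "1 - \<theta> < ?q" using q(3) by linarith
      ultimately have "1 - \<theta> \<le> (1 + \<theta> - \<rho>)\<^sup>2" "1 - \<theta> < 1 + \<theta> - \<rho>"
        using q by linarith+
      then show ?thesis using rho_sigma2 2 theta by simp
    qed
    then show "0 < \<rho>" "\<theta> * \<sigma> = \<rho>" "1 - \<theta> \<le> (1 + \<theta> - \<rho>)\<^sup>2" "1 - \<theta> < 1 + \<theta> - \<rho>"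
      by blast+
  qed
  have sigma: "0 < \<sigma>" using relaxation theta by (metis zero_less_mult_pos)
  interpret primal_dual_forms \<Omega> L Ls \<theta> r s \<rho> \<sigma>
    using L(2) Ls rs relaxation sigma
    by unfold_locales (auto simp: L2_bounded_linear_def)
  let ?\<Phi> = "\<lambda>z. g_fun \<Omega> \<tau> \<beta> (fst z) + f_conj \<Omega> uT (snd z)"
  let ?w = "\<lambda>k. (u k, p k)" and ?wt = "\<lambda>k. (ut k, pt k)"
  define c0 where "c0 = (1 - \<kappa>) * min (2 - \<rho>) (2 - \<sigma>) / (2 * \<sigma>)"
  note coercive = S_form_coercive[OF theta relaxation(3,4) L(2) \<kappa>_def kappa, folded c0_def]
  have mem: "?w k \<in> pairs" "?wt k \<in> pairs" "(us, ps) \<in> pairs" for k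
    using iter saddle
    by (auto simp: primal_dual_iteration_def is_arg_min_def is_arg_max_def saddle_point_def)
  have c0: "0 < c0" using coercive(3)[OF mem(3)] .
  have lmeasurable: "\<Omega> \<in> lmeasurable"
    using domain by (simp add: bounded_set_imp_lmeasurable)
  then have convex: "L2_convex \<Omega> (g_fun \<Omega> \<tau> \<beta>)"
    using params by (simp add: L2_convex_g_fun)
  have relax: "W_eq (?w (Suc k)) (W_diff (?w k) (D (W_diff (?w k) (?wt k))))" for k
    using iter by (simp add: primal_dual_iteration_def W_eq_def W_diff_def D_op_def)
  note predictor = primal_dual_resolvent_inequality[OF convex uT iter]
  note solution = saddle_point_resolvent_inequality[OF saddle]
  have "K_normsq \<Omega> L Ls \<theta> r s \<rho> \<sigma> (D (W_diff (?w K) (?wt K)))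
    \<le> 1 / (c0 * (real K + 1)) * K_normsq \<Omega> L Ls \<theta> r s \<rho> \<sigma> (W_diff (?w 0) (us, ps))" for K
    by (rule residual_rate[where w = ?w and wt = ?wt and ws = "(us, ps)" and \<Phi> = ?\<Phi>])
      (fact mem relax predictor solution coercive(1) c0 coercive(2))+
  then show ?thesis using c0 by blast
qed

end
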